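(* Let $l,\alpha,k>0$. The map $\Gamma:\mathrm{wp}(\mathbb{C})\to\mathrm{gl}(4,\mathbb{C})$, $\Gamma([\mathbf{M}])=\mathbf{G}_{\mathbf{M}}$, is a one-to-one correspondence (bijection), and $\Gamma(\mathrm{wp}(\mathbb{R}))=\overline{\pi}(4)$.
   Context: Fix $l,\alpha,k>0$. $\mathrm{gl}(m,n,\mathbb{C})$ is the set of complex $m\times n$ matrices, $\mathrm{gl}(n,\mathbb{C})=\mathrm{gl}(n,n,\mathbb{C})$; $L^2[-l,l]$ is the Hilbert space of complex-valued square-integrable functions. Matrices. $\omega_j=e^{\sqrt{-1}\,\frac{\pi}{4}(2j-1)}$ ($j\in\mathbb{Z}$), $\mathbf{\Omega}=\mathrm{diag}(\omega_1,\omega_2,\omega_3,\omega_4)$, $\mathcal{E}=\mathrm{diag}(1,-1,-1,1)$, and $\mathbf{L}^2=\begin{pmatrix}0&0&1&0\\0&0&0&1\\1&0&0&0\\0&1&0&0\end{pmatrix}$. Let $\mathbf{y}(x)=(e^{\omega_1\alpha x},e^{\omega_2\alpha x},e^{\omega_3\alpha x},e^{\omega_4\alpha x})^T$ and $\mathbf{W}(x)=\left((\omega_q\alpha)^{p-1}e^{\omega_q\alpha x}\right)_{1\le p,q\le 4}$ (row index $p$, column index $q$), which is invertible for every $x$. Well-posedness. Write $\mathbf{M}=(\mathbf{M}^-\ \mathbf{M}^+)\in\mathrm{gl}(4,8,\mathbb{C})$ with $\mathbf{M}^\pm\in\mathrm{gl}(4,\mathbb{C})$. For $u\in C^3[-l,l]$,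 $\mathcal{B}[u]=(u(-l),u'(-l),u''(-l),u'''(-l),u(l),u'(l),u''(l),u'''(l))^T$. $\mathbf{M}$ is well-posed if $u=0$ is the only solution of $u^{(4)}+\alpha^4u=0$ on $[-l,l]$ with $\mathbf{M}\cdot\mathcal{B}[u]=\mathbf{0}$; $\mathrm{wp}(4,8,\mathbb{C})$ is the set of well-posed matrices, and $\mathrm{wp}(4,8,\mathbb{R})$ is the subset of those with real entries. Put $\widetilde{\mathbf{M}}^-=\mathbf{M}^-\mathbf{W}(-l)$, $\widetilde{\mathbf{M}}^+=\mathbf{M}^+\mathbf{W}(l)$, $\widetilde{\mathbf{M}}=\widetilde{\mathbf{M}}^-+\widetilde{\mathbf{M}}^+$ (invertible when $\mathbf{M}$ is well-posed). For well-posed $\mathbf{M}$ let $\mathbf{G}_{\mathbf{M}}^\pm=\widetilde{\mathbf{M}}^{-1}\widetilde{\mathbf{M}}^\pm\mathbf{\Omega}\mathbf{L}^2$. Operator and equivalence. The Green's function is $G_{\mathbf{M}}(x,\xi)=\frac{\alpha}{4k}\mathbf{y}(x)^T\mathbf{G}_{\mathbf{M}}^+\mathbf{y}(\xi)$ if $x\le\xi$ and $-\frac{\alpha}{4k}\mathbf{y}(x)^T\mathbf{G}_{\mathbf{M}}^-\mathbf{y}(\xi)$ if $\xi\le x$, and $\mathcal{K}_{\mathbf{M}}:L^2[-l,l]\to L^2[-l,l]$ is $\mathcal{K}_{\mathbf{M}}[w](x)=\int_{-l}^lG_{\mathbf{M}}(x,\xi)w(\xi)\,d\xi$. For $\mathbf{M},\mathbf{N}\in\mathrm{wp}(4,8,\mathbb{C})$,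 $\mathbf{M}\approx\mathbf{N}$ means $\mathcal{K}_{\mathbf{M}}=\mathcal{K}_{\mathbf{N}}$. $\mathrm{wp}(\mathbb{C})=\mathrm{wp}(4,8,\mathbb{C})/\!\approx$, $[\mathbf{M}]$ is the class of $\mathbf{M}$, and $\mathrm{wp}(\mathbb{R})=\{[\mathbf{M}]:\mathbf{M}\in\mathrm{wp}(4,8,\mathbb{R})\}\subset\mathrm{wp}(\mathbb{C})$. The matrix $\mathbf{Q}=\left(\begin{array}{cccc|cccc}0&\alpha^2&-\sqrt2\alpha&1&0&0&0&0\\ \sqrt2\alpha^3&-\alpha^2&0&1&0&0&0&0\\0&0&0&0&0&\alpha^2&\sqrt2\alpha&1\\0&0&0&0&-\sqrt2\alpha^3&-\alpha^2&0&1\end{array}\right)$ is well-posed. For $\mathbf{M}\in\mathrm{wp}(4,8,\mathbb{C})$, the $4\times4$ matrix $\mathbf{G}_{\mathbf{M}}$ (not to be confused with the function $G_{\mathbf{M}}$) is $\mathbf{G}_{\mathbf{M}}=(\mathbf{G}_{\mathbf{M}}^+-\mathbf{G}_{\mathbf{Q}}^+)(\mathbf{\Omega}\mathbf{L}^2)^{-1}\mathcal{E}$; it depends only on $[\mathbf{M}]$. $\mathbf{R}$ is the $n\times n$ matrix with ones on the anti-diagonal and zeros elsewhere, and $\overline{\pi}(n)=\{\mathbf{A}\in\mathrm{gl}(n,\mathbb{C}):\mathbf{R}\overline{\mathbf{A}}\mathbf{R}=\mathbf{A}\}$, where $\overline{\mathbf{A}}$ is the entrywise complex conjugate. *)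

theory Defs
  imports "HOL-Analysis.Analysis"
begin

(* The index type of a vector of length n is the numeral type n, in which the numeral n is 0.
   pos i is the position of i in {1,...,n}, so that pos (4::4) = 4. *)
definition pos :: "'n::{finite,semiring_1} \<Rightarrow> nat" where
  "pos = inv_into {1..CARD('n)} of_nat"

definition diag_mat :: "complex^'n \<Rightarrow> complex^'n^'n" where
  "diag_mat v = (\<chi> i j. if i = j then v $ i else 0)"

definition omega :: "int \<Rightarrow> complex" where
  "omega j = exp (\<i> * complex_of_real (pi / 4) * of_int (2 * j - 1))"

definition Omega :: "complex^4^4" where
  "Omega = diag_mat (vector [omega 1, omega 2, omega 3, omega 4])"

definition E_mat :: "complex^4^4" where
  "E_mat = diag_mat (vector [1, -1, -1, 1])"

(* the matrix written as the square of L *)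
definition Lsq :: "complex^4^4" where
  "Lsq = vector [vector [0, 0, 1, 0],
                 vector [0, 0, 0, 1],
                 vector [1, 0, 0, 0],
                 vector [0, 1, 0, 0]]"

definition y_vec :: "real \<Rightarrow> real \<Rightarrow> complex^4" where
  "y_vec \<alpha> x = (\<chi> q. exp (omega (int (pos q)) * of_real \<alpha> * of_real x))"

definition W_mat :: "real \<Rightarrow> real \<Rightarrow> complex^4^4" where
  "W_mat \<alpha> x = (\<chi> p q. (omega (int (pos q)) * of_real \<alpha>) ^ (pos p - 1)
                        * exp (omega (int (pos q)) * of_real \<alpha> * of_real x))"

(* M = (minus_part M | plus_part M) *)
definition minus_part :: "complex^8^4 \<Rightarrow> complex^4^4" where
  "minus_part M = (\<chi> i j. M $ i $ of_nat (pos j))"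

definition plus_part :: "complex^8^4 \<Rightarrow> complex^4^4" where
  "plus_part M = (\<chi> i j. M $ i $ of_nat (pos j + 4))"

(* n-th derivative of a function on [-l,l], one-sided at the end points *)
definition nderiv :: "real \<Rightarrow> nat \<Rightarrow> (real \<Rightarrow> complex) \<Rightarrow> real \<Rightarrow> complex" where
  "nderiv l n = ((\<lambda>u x. vector_derivative u (at x within {-l..l})) ^^ n)"

definition boundary_values :: "real \<Rightarrow> (real \<Rightarrow> complex) \<Rightarrow> complex^8" where
  "boundary_values l u =
     vector [nderiv l 0 u (-l), nderiv l 1 u (-l), nderiv l 2 u (-l), nderiv l 3 u (-l),
             nderiv l 0 u l, nderiv l 1 u l, nderiv l 2 u l, nderiv l 3 u l]"

definition ode_solution :: "real \<Rightarrow> real \<Rightarrow> (real \<Rightarrow> complex) \<Rightarrow> bool" where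
  "ode_solution l \<alpha> u \<longleftrightarrow>
     (\<forall>n<4. \<forall>x\<in>{-l..l}. nderiv l n u differentiable (at x within {-l..l})) \<and>
     (\<forall>x\<in>{-l..l}. nderiv l 4 u x + of_real (\<alpha> ^ 4) * u x = 0)"

definition well_posed :: "real \<Rightarrow> real \<Rightarrow> complex^8^4 \<Rightarrow> bool" where
  "well_posed l \<alpha> M \<longleftrightarrow>
     (\<forall>u. ode_solution l \<alpha> u \<and> M *v boundary_values l u = 0 \<longrightarrow> (\<forall>x\<in>{-l..l}. u x = 0))"

definition wp_mat :: "real \<Rightarrow> real \<Rightarrow> (complex^8^4) set" where
  "wp_mat l \<alpha> = {M. well_posed l \<alpha> M}"

definition wp_mat_real :: "real \<Rightarrow> real \<Rightarrow> (complex^8^4) set" where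
  "wp_mat_real l \<alpha> = {M \<in> wp_mat l \<alpha>. \<forall>i j. M $ i $ j \<in> \<real>}"

definition tilde_minus :: "real \<Rightarrow> real \<Rightarrow> complex^8^4 \<Rightarrow> complex^4^4" where
  "tilde_minus l \<alpha> M = minus_part M ** W_mat \<alpha> (-l)"

definition tilde_plus :: "real \<Rightarrow> real \<Rightarrow> complex^8^4 \<Rightarrow> complex^4^4" where
  "tilde_plus l \<alpha> M = plus_part M ** W_mat \<alpha> l"

definition tilde :: "real \<Rightarrow> real \<Rightarrow> complex^8^4 \<Rightarrow> complex^4^4" where
  "tilde l \<alpha> M = tilde_minus l \<alpha> M + tilde_plus l \<alpha> M"

definition G_minus :: "real \<Rightarrow> real \<Rightarrow> complex^8^4 \<Rightarrow> complex^4^4" where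
  "G_minus l \<alpha> M = matrix_inv (tilde l \<alpha> M) ** tilde_minus l \<alpha> M ** Omega ** Lsq"

definition G_plus :: "real \<Rightarrow> real \<Rightarrow> complex^8^4 \<Rightarrow> complex^4^4" where
  "G_plus l \<alpha> M = matrix_inv (tilde l \<alpha> M) ** tilde_plus l \<alpha> M ** Omega ** Lsq"

(* v^T A w, without complex conjugation *)
definition bilin :: "complex^4 \<Rightarrow> complex^4^4 \<Rightarrow> complex^4 \<Rightarrow> complex" where
  "bilin v A w = (\<Sum>p\<in>UNIV. v $ p * (A *v w) $ p)"

(* The two defining formulas agree for x = xi, because omega 1 + ... + omega 4 = 0. *)
definition green :: "real \<Rightarrow> real \<Rightarrow> real \<Rightarrow> complex^8^4 \<Rightarrow> real \<Rightarrow> real \<Rightarrow> complex" where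
  "green l \<alpha> k M x \<xi> =
     (if x \<le> \<xi> then of_real (\<alpha> / (4 * k)) * bilin (y_vec \<alpha> x) (G_plus l \<alpha> M) (y_vec \<alpha> \<xi>)
      else - of_real (\<alpha> / (4 * k)) * bilin (y_vec \<alpha> x) (G_minus l \<alpha> M) (y_vec \<alpha> \<xi>))"

(* Elements of L^2[-l,l] are given by representatives; equality in L^2 is
   equality almost everywhere on [-l,l]. *)
definition L2_fun :: "real \<Rightarrow> (real \<Rightarrow> complex) set" where
  "L2_fun l = {w. w \<in> borel_measurable (lebesgue_on {-l..l}) \<and>
                  integrable (lebesgue_on {-l..l}) (\<lambda>x. (norm (w x))\<^sup>2)}"

definition L2_eq :: "real \<Rightarrow> (real \<Rightarrow> complex) \<Rightarrow> (real \<Rightarrow> complex) \<Rightarrow> bool" where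
  "L2_eq l f g \<longleftrightarrow> (AE x in lebesgue_on {-l..l}. f x = g x)"

definition K_op :: "real \<Rightarrow> real \<Rightarrow> real \<Rightarrow> complex^8^4 \<Rightarrow> (real \<Rightarrow> complex) \<Rightarrow> real \<Rightarrow> complex" where
  "K_op l \<alpha> k M w x = (LINT \<xi>|lebesgue_on {-l..l}. green l \<alpha> k M x \<xi> * w \<xi>)"

definition wp_equiv :: "real \<Rightarrow> real \<Rightarrow> real \<Rightarrow> ((complex^8^4) \<times> (complex^8^4)) set" where
  "wp_equiv l \<alpha> k = {(M, N). M \<in> wp_mat l \<alpha> \<and> N \<in> wp_mat l \<alpha> \<and>
                            (\<forall>w\<in>L2_fun l. L2_eq l (K_op l \<alpha> k M w) (K_op l \<alpha> k N w))}"

definition wp_class :: "real \<Rightarrow> real \<Rightarrow> real \<Rightarrow> complex^8^4 \<Rightarrow> (complex^8^4) set" where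
  "wp_class l \<alpha> k M = wp_equiv l \<alpha> k `` {M}"

definition wp_C :: "real \<Rightarrow> real \<Rightarrow> real \<Rightarrow> (complex^8^4) set set" where
  "wp_C l \<alpha> k = wp_mat l \<alpha> // wp_equiv l \<alpha> k"

definition wp_R :: "real \<Rightarrow> real \<Rightarrow> real \<Rightarrow> (complex^8^4) set set" where
  "wp_R l \<alpha> k = {wp_class l \<alpha> k M | M. M \<in> wp_mat_real l \<alpha>}"

definition Q_mat :: "real \<Rightarrow> complex^8^4" where
  "Q_mat \<alpha> = map_matrix complex_of_real (vector
     [vector [0, \<alpha>^2, - sqrt 2 * \<alpha>, 1, 0, 0, 0, 0],
      vector [sqrt 2 * \<alpha>^3, - (\<alpha>^2), 0, 1, 0, 0, 0, 0],
      vector [0, 0, 0, 0, 0, \<alpha>^2, sqrt 2 * \<alpha>, 1],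
      vector [0, 0, 0, 0, - sqrt 2 * \<alpha>^3, - (\<alpha>^2), 0, 1]])"

definition G_mat :: "real \<Rightarrow> real \<Rightarrow> complex^8^4 \<Rightarrow> complex^4^4" where
  "G_mat l \<alpha> M = (G_plus l \<alpha> M - G_plus l \<alpha> (Q_mat \<alpha>)) ** matrix_inv (Omega ** Lsq) ** E_mat"

(* the common value of G_mat on a class *)
definition Gamma_map :: "real \<Rightarrow> real \<Rightarrow> real \<Rightarrow> (complex^8^4) set \<Rightarrow> complex^4^4" where
  "Gamma_map l \<alpha> k c = the_elem (G_mat l \<alpha> ` c)"

definition R_mat :: "((complex, 'n::{finite,semiring_1}) vec, 'n) vec" where
  "R_mat = (\<chi> i j. if pos i + pos j = CARD('n) + 1 then 1 else 0)"

definition pi_bar :: "(((complex, 'n::{finite,semiring_1}) vec, 'n) vec) set" where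
  "pi_bar = {A. R_mat ** map_matrix cnj A ** R_mat = A}"

lemma pos_4: "pos (1::4) = 1" "pos (2::4) = 2" "pos (3::4) = 3" "pos (4::4) = 4"
proof -
  have inj: "inj_on (of_nat :: nat \<Rightarrow> 4) {1..CARD(4)}"
  proof -
    have "{1..CARD(4)} = {1, 2, 3, 4}" by auto
    then show ?thesis by (simp add: inj_on_def)
  qed
  have "pos (of_nat n :: 4) = n" if "n \<in> {1..4}" for n
    unfolding pos_def using inv_into_f_f[OF inj] that by simp
  from this[of 1] this[of 2] this[of 3] this[of 4]
  show "pos (1::4) = 1" "pos (2::4) = 2" "pos (3::4) = 3" "pos (4::4) = 4" by simp_all
qed

lemma vector_8:
  "(vector [a, b, c, d, e, f, g, h] :: 'a::zero^8) $ 1 = a"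
  "(vector [a, b, c, d, e, f, g, h] :: 'a::zero^8) $ 2 = b"
  "(vector [a, b, c, d, e, f, g, h] :: 'a::zero^8) $ 3 = c"
  "(vector [a, b, c, d, e, f, g, h] :: 'a::zero^8) $ 4 = d"
  "(vector [a, b, c, d, e, f, g, h] :: 'a::zero^8) $ 5 = e"
  "(vector [a, b, c, d, e, f, g, h] :: 'a::zero^8) $ 6 = f"
  "(vector [a, b, c, d, e, f, g, h] :: 'a::zero^8) $ 7 = g"
  "(vector [a, b, c, d, e, f, g, h] :: 'a::zero^8) $ 8 = h"
  by (simp_all add: vector_def)

lemma vector_4:
  "(vector [a, b, c, d] :: 'a::zero^4) $ 1 = a"
  "(vector [a, b, c, d] :: 'a::zero^4) $ 2 = b"
  "(vector [a, b, c, d] :: 'a::zero^4) $ 3 = c"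
  "(vector [a, b, c, d] :: 'a::zero^4) $ 4 = d"
  by (simp_all add: vector_def)

end

theory Submission
  imports Defs
begin

text \<open>
  The solutions of the equation are the combinations of \<open>exp (\<omega>\<^sub>q \<alpha> x)\<close>, and on
  the coefficient vector of such a combination the boundary condition acts as \<open>tilde M\<close>; hence \<open>M\<close>
  is well-posed iff \<open>tilde M\<close> is invertible. Put \<open>P\<^sub>M = (tilde M)\<^bsup>-1\<^esup> (tilde_plus M)\<close>. As
  \<open>G_plus + G_minus = \<Omega> L\<^sup>2\<close>, two Green's functions differ on both triangles by the single bilinear
  form \<open>y(x)\<^sup>T (G_plus M - G_plus N) y(\<xi>)\<close>, and testing the operators against conjugates of its rows
  shows that \<open>M \<approx> N\<close> iff \<open>P\<^sub>M = P\<^sub>N\<close>. Since \<open>G\<^sub>M = (P\<^sub>M - P\<^sub>Q) E\<close>, the claim reduces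
  to: \<open>P\<close> takes every value (choose \<open>M\<^sup>+ = W(0) P W(l)\<^bsup>-1\<^esup>\<close> and
  \<open>M\<^sup>- = W(0) (1 - P) W(-l)\<^bsup>-1\<^esup>\<close>), and, because complex conjugation turns \<open>W\<close> into \<open>W R\<close>,
  classes of real matrices \<open>M\<close> correspond exactly to the \<open>P\<close> in \<open>pi_bar\<close>.
\<close>

subsection \<open>Exponential solutions and well-posedness\<close>

definition lam :: "real \<Rightarrow> 4 \<Rightarrow> complex" where
  "lam \<alpha> q = omega (int (pos q)) * of_real \<alpha>"

definition exp_comb :: "real \<Rightarrow> complex^4 \<Rightarrow> real \<Rightarrow> complex" where
  "exp_comb \<alpha> c x = (\<Sum>q\<in>UNIV. c $ q * exp (lam \<alpha> q * of_real x))"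

section \<open>The fourth roots and the exponents of the equation\<close>

lemma omega_add_one: "omega (j + 1) = \<i> * omega j"
proof -
  have "omega (j + 1) = exp (\<i> * of_real (pi / 4) * of_int (2 * j - 1) + \<i> * of_real (pi / 2))"
    unfolding omega_def by (rule arg_cong[where f = exp]) (simp add: field_simps)
  also have "\<dots> = omega j * cis (pi / 2)"
    by (simp only: exp_add omega_def cis_conv_exp)
  finally show ?thesis by simp
qed

lemma omega_values:
  "omega 2 = \<i> * omega 1" "omega 3 = - omega 1" "omega 4 = - \<i> * omega 1"
  using omega_add_one[of 1] omega_add_one[of 2] omega_add_one[of 3] by simp_all

lemma omega_one: "omega 1 = Complex (sqrt 2 / 2) (sqrt 2 / 2)"
  using cis_conv_exp[of "pi / 4"]
  by (simp add: omega_def complex_eq_iff cos_45 sin_45)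

lemma omega_one_sq: "omega 1 * omega 1 = \<i>"
  by (simp add: omega_one complex_eq_iff)

lemma omega_nonzero: "omega j \<noteq> 0"
  by (simp add: omega_def)

lemma cnj_omega: "cnj (omega 1) = omega 4" "cnj (omega 2) = omega 3"
  "cnj (omega 3) = omega 2" "cnj (omega 4) = omega 1"
  by (simp_all add: omega_values omega_one complex_eq_iff)

text \<open>Writing all four exponents through \<open>lam \<alpha> 1\<close> turns sums over q into
  polynomial identities in one unknown and \<i>, which simplification can decide.\<close>

lemma lam_values:
  "lam \<alpha> 1 = omega 1 * of_real \<alpha>" "lam \<alpha> 2 = \<i> * lam \<alpha> 1"
  "lam \<alpha> 3 = - lam \<alpha> 1" "lam \<alpha> 4 = - \<i> * lam \<alpha> 1"
  by (simp_all only: lam_def pos_4) (simp_all add: omega_values)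

lemma lam_pow4: "lam \<alpha> q ^ 4 = - of_real (\<alpha> ^ 4)"
proof -
  have "omega 1 ^ 4 = -1"
    using arg_cong[OF omega_one_sq, of "\<lambda>z. z * z"] by (simp add: power4_eq_xxxx mult.assoc)
  then have "lam \<alpha> 1 ^ 4 = - of_real (\<alpha> ^ 4)"
    by (simp add: lam_values power_mult_distrib)
  then have "\<forall>q. lam \<alpha> q ^ 4 = - of_real (\<alpha> ^ 4)"
    by (simp add: forall_4 lam_values(2-) power_mult_distrib)
  then show ?thesis by blast
qed

lemma lam_nonzero: "\<alpha> > 0 \<Longrightarrow> lam \<alpha> q \<noteq> 0"
  by (simp add: lam_def omega_nonzero)

section \<open>Derivatives on the interval and the solution space\<close>

lemma exp_mult_has_vector_derivative:
  fixes a :: complex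
  shows "((\<lambda>x. exp (a * of_real x)) has_vector_derivative a * exp (a * of_real x)) (at x within S)"
proof -
  have "((\<lambda>z. exp (a * z)) has_field_derivative a * exp (a * of_real x)) (at (of_real x))"
    by (auto intro!: derivative_eq_intros)
  then show ?thesis by (rule has_vector_derivative_real_field)
qed

lemma exp_comb_has_vector_derivative:
  "(exp_comb \<alpha> c has_vector_derivative exp_comb \<alpha> (\<chi> q. lam \<alpha> q * c $ q) x) (at x within S)"
proof -
  have "((\<lambda>x. \<Sum>q\<in>UNIV. c $ q * exp (lam \<alpha> q * of_real x)) has_vector_derivative
      (\<Sum>q\<in>UNIV. c $ q * (lam \<alpha> q * exp (lam \<alpha> q * of_real x)))) (at x within S)"
    by (intro has_vector_derivative_sum has_vector_derivative_mult_right exp_mult_has_vector_derivative)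
  then show ?thesis by (simp add: exp_comb_def[abs_def] mult_ac)
qed

lemma continuous_on_exp_comb: "continuous_on S (exp_comb \<alpha> c)"
  unfolding exp_comb_def by (intro continuous_intros)

lemma nderiv_0: "nderiv l 0 u = u"
  by (simp add: nderiv_def)

lemma nderiv_Suc: "nderiv l (Suc n) u x = vector_derivative (nderiv l n u) (at x within {-l..l})"
  by (simp add: nderiv_def)

text \<open>All derivatives are taken within [-l,l], so values outside are irrelevant. This matters
  because a solution is known to be an exponential combination only on the interval.\<close>

lemma nderiv_cong:
  assumes "\<And>x. x \<in> {-l..l} \<Longrightarrow> u x = v x" and "x \<in> {-l..l}"
  shows "nderiv l n u x = nderiv l n v x"
  using assms(2)
proof (induction n arbitrary: x)
  case 0
  then show ?case using assms(1) by (simp add: nderiv_0)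
next
  case (Suc n)
  \<comment> \<open>\<open>vector_derivative\<close> is a choice among all d with this property;
    equivalence for every d makes the two choices agree even where no derivative exists.\<close>
  have "(nderiv l n u has_vector_derivative d) (at x within {-l..l}) \<longleftrightarrow>
        (nderiv l n v has_vector_derivative d) (at x within {-l..l})" for d
    using Suc by (metis has_vector_derivative_transform)
  then show ?case by (simp add: nderiv_Suc vector_derivative_def)
qed

context
  fixes l \<alpha> :: real
  assumes l: "l > 0" and \<alpha>: "\<alpha> > 0"
begin

lemma nderiv_exp_comb:
  assumes "x \<in> {-l..l}"
  shows "nderiv l n (exp_comb \<alpha> c) x = exp_comb \<alpha> (\<chi> q. lam \<alpha> q ^ n * c $ q) x"
  using assms
proof (induction n arbitrary: x)
  case 0
  then show ?case by (simp add: nderiv_0)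
next
  case (Suc n)
  have "(nderiv l n (exp_comb \<alpha> c) has_vector_derivative
      exp_comb \<alpha> (\<chi> q. lam \<alpha> q * (\<chi> q. lam \<alpha> q ^ n * c $ q) $ q) x) (at x within {-l..l})"
    using has_vector_derivative_transform[OF Suc.prems Suc.IH exp_comb_has_vector_derivative] .
  then have "vector_derivative (nderiv l n (exp_comb \<alpha> c)) (at x within {-l..l})
      = exp_comb \<alpha> (\<chi> q. lam \<alpha> q * (\<chi> q. lam \<alpha> q ^ n * c $ q) $ q) x"
    \<comment> \<open>As l > 0, the interval is nondegenerate, so the derivative is unique also at
      the end points.\<close>
    by (rule vector_derivative_within_closed_interval[rotated 2]) (use l Suc.prems in auto)
  then show ?case by (simp add: nderiv_Suc mult.assoc)
qed

lemma ode_solution_exp_comb: "ode_solution l \<alpha> (exp_comb \<alpha> c)"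
  unfolding ode_solution_def
proof (intro conjI ballI allI impI)
  fix n :: nat and x
  assume x: "x \<in> {-l..l}"
  have "(nderiv l n (exp_comb \<alpha> c) has_vector_derivative
      exp_comb \<alpha> (\<chi> q. lam \<alpha> q * (\<chi> q. lam \<alpha> q ^ n * c $ q) $ q) x) (at x within {-l..l})"
    using has_vector_derivative_transform[OF x nderiv_exp_comb exp_comb_has_vector_derivative] .
  then show "nderiv l n (exp_comb \<alpha> c) differentiable at x within {-l..l}"
    by (rule differentiableI_vector)
next
  fix x
  assume x: "x \<in> {-l..l}"
  show "nderiv l 4 (exp_comb \<alpha> c) x + of_real (\<alpha> ^ 4) * exp_comb \<alpha> c x = 0"
    by (simp only: nderiv_exp_comb[OF x] lam_pow4)
       (simp add: exp_comb_def sum_distrib_left mult.assoc sum_negf)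
qed

text \<open>The combination
  \<open>\<lambda>\<^sup>3 u + \<lambda>\<^sup>2 u' + \<lambda> u'' + u'''\<close> with \<open>\<lambda>\<^sup>4 = - \<alpha>\<^sup>4\<close> solves the first-order
  equation \<open>p' = \<lambda> p\<close>, since \<open>z\<^sup>4 + \<alpha>\<^sup>4\<close> is divisible by \<open>z - \<lambda>\<close>.\<close>
lemma ode_solution_first_order:
  assumes u: "ode_solution l \<alpha> u"
  shows "\<exists>C. \<forall>x\<in>{-l..l}. (\<Sum>j<4. lam \<alpha> q ^ (3 - j) * nderiv l j u x) = C * exp (lam \<alpha> q * of_real x)"
proof -
  define \<mu> where "\<mu> = lam \<alpha> q"
  define p where "p = (\<lambda>x. \<Sum>j<4. \<mu> ^ (3 - j) * nderiv l j u x)"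
  have d: "(nderiv l n u has_vector_derivative nderiv l (Suc n) u x) (at x within {-l..l})"
    if "n < 4" "x \<in> {-l..l}" for n x
    using u that unfolding ode_solution_def nderiv_Suc
    by (simp add: vector_derivative_works)
  have p': "(p has_vector_derivative \<mu> * p x) (at x within {-l..l})" if x: "x \<in> {-l..l}" for x
  proof -
    have "(p has_vector_derivative (\<Sum>j<4. \<mu> ^ (3 - j) * nderiv l (Suc j) u x)) (at x within {-l..l})"
      unfolding p_def
      by (rule has_vector_derivative_sum, rule has_vector_derivative_mult_right, rule d) (use x in auto)
    \<comment> \<open>The equation turns the top term of the shifted sum into \<mu>^4 u, exactly the
      term of \<mu> p that the shift lost.\<close>
    moreover have "nderiv l 4 u x = \<mu> ^ 4 * u x"
      using u x unfolding ode_solution_def \<mu>_def lam_pow4 by (simp add: eq_neg_iff_add_eq_0)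
    then have "(\<Sum>j<4. \<mu> ^ (3 - j) * nderiv l (Suc j) u x) = \<mu> * p x"
      by (simp add: p_def eval_nat_numeral nderiv_0 algebra_simps)
    ultimately show ?thesis by simp
  qed
  \<comment> \<open>Integrating factor: p x exp(-\<mu> x) has derivative zero.\<close>
  have z: "((\<lambda>x. p x * exp (- \<mu> * of_real x)) has_vector_derivative 0) (at x within {-l..l})"
    if x: "x \<in> {-l..l}" for x
    using has_vector_derivative_mult[OF p'[OF x] exp_mult_has_vector_derivative[of "- \<mu>"]]
    by (simp add: algebra_simps)
  obtain C where "\<And>x. x \<in> {-l..l} \<Longrightarrow> p x * exp (- \<mu> * of_real x) = C"
    using has_vector_derivative_zero_constant[OF convex_real_interval(5) z] by metis
  then have "\<forall>x\<in>{-l..l}. p x = C * exp (\<mu> * of_real x)"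
    by (auto simp: exp_minus field_simps)
  then show ?thesis unfolding p_def \<mu>_def by blast
qed

text \<open>Weight the q-th first-order identity by \<open>lam \<alpha> q\<close> and sum over q.
  The derivative of order j then carries the power sum of exponent 4 - j of the four roots, which
  vanishes for j = 1, 2, 3. Only 4 \<lambda>^4 u = -4 \<alpha>^4 u remains, and dividing by -4
  \<alpha>^4 gives the coefficients c.\<close>

lemma ode_solution_is_exp_comb:
  assumes u: "ode_solution l \<alpha> u"
  obtains c where "\<And>x. x \<in> {-l..l} \<Longrightarrow> u x = exp_comb \<alpha> c x"
proof -
  obtain C where C: "\<And>q x. x \<in> {-l..l} \<Longrightarrow>
      (\<Sum>j<4. lam \<alpha> q ^ (3 - j) * nderiv l j u x) = C q * exp (lam \<alpha> q * of_real x)"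
    using ode_solution_first_order[OF u] by metis
  define c :: "complex^4" where "c = (\<chi> q. - lam \<alpha> q * C q / (4 * of_real (\<alpha> ^ 4)))"
  have "u x = exp_comb \<alpha> c x" if x: "x \<in> {-l..l}" for x
  proof -
    have a: "of_real \<alpha> \<noteq> (0::complex)" using \<alpha> by simp
    have "(\<Sum>q\<in>UNIV. lam \<alpha> q * (C q * exp (lam \<alpha> q * of_real x)))
        = (\<Sum>q\<in>UNIV. lam \<alpha> q * (\<Sum>j<4. lam \<alpha> q ^ (3 - j) * nderiv l j u x))"
      using C[OF x] by simp
    also have "\<dots> = 4 * lam \<alpha> 1 ^ 4 * u x"
      by (simp add: sum_4 lam_values(2-) eval_nat_numeral nderiv_0 algebra_simps)
    finally have "(\<Sum>q\<in>UNIV. lam \<alpha> q * (C q * exp (lam \<alpha> q * of_real x))) = - 4 * of_real (\<alpha> ^ 4) * u x"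
      by (simp add: lam_pow4)
    moreover have "exp_comb \<alpha> c x = - (\<Sum>q\<in>UNIV. lam \<alpha> q * (C q * exp (lam \<alpha> q * of_real x))) / (4 * of_real (\<alpha> ^ 4))"
      unfolding exp_comb_def c_def by (simp add: sum_divide_distrib sum_negf mult.assoc)
    ultimately show ?thesis using a by simp
  qed
  then show ?thesis by (rule that)
qed

end

section \<open>The matrices W(x) and the criterion for well-posedness\<close>

lemma W_mat_mult:
  "(W_mat \<alpha> x *v c) $ p = exp_comb \<alpha> (\<chi> q. lam \<alpha> q ^ (pos p - 1) * c $ q) x"
  by (simp add: W_mat_def matrix_vector_mult_def exp_comb_def lam_def mult_ac)

text \<open>Up to powers of \<open>lam \<alpha> 1\<close>, the rows are a discrete Fourier transform
  of length 4 applied to the terms t. Both the invertibility of W and the computation for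
  \<open>Q_mat\<close> rest on this form.\<close>

lemma W_mat_mult_components:
  fixes c :: "complex^4" and \<alpha> x :: real
  defines "t \<equiv> \<lambda>q. c $ q * exp (lam \<alpha> q * of_real x)"
  shows "(W_mat \<alpha> x *v c) $ 1 = t 1 + t 2 + t 3 + t 4"
    and "(W_mat \<alpha> x *v c) $ 2 = lam \<alpha> 1 * (t 1 + \<i> * t 2 - t 3 - \<i> * t 4)"
    and "(W_mat \<alpha> x *v c) $ 3 = lam \<alpha> 1 ^ 2 * (t 1 - t 2 + t 3 - t 4)"
    and "(W_mat \<alpha> x *v c) $ 4 = lam \<alpha> 1 ^ 3 * (t 1 - \<i> * t 2 - t 3 + \<i> * t 4)"
  unfolding t_def
  by (simp_all add: W_mat_mult exp_comb_def sum_4 pos_4 lam_values(2-) algebra_simps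
      eval_nat_numeral)

lemma invertible_if_kernel_trivial:
  fixes A :: "'a::field^'n^'n"
  assumes "\<And>x. A *v x = 0 \<Longrightarrow> x = 0"
  shows "invertible A"
  using assms matrix_left_invertible_ker[of A] invertible_left_inverse[of A] by auto

lemma invertible_W_mat:
  assumes \<alpha>: "\<alpha> > 0"
  shows "invertible (W_mat \<alpha> x)"
proof (rule invertible_if_kernel_trivial)
  fix c :: "complex^4"
  assume W: "W_mat \<alpha> x *v c = 0"
  define t where "t q = c $ q * exp (lam \<alpha> q * of_real x)" for q
  have "t 1 + t 2 + t 3 + t 4 = 0" "t 1 + \<i> * t 2 - t 3 - \<i> * t 4 = 0"
    "t 1 - t 2 + t 3 - t 4 = 0" "t 1 - \<i> * t 2 - t 3 + \<i> * t 4 = 0"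
    using W_mat_mult_components[of \<alpha> x c, folded t_def] lam_nonzero[OF \<alpha>, of 1] by (simp_all add: W)
  \<comment> \<open>Real and imaginary parts of the four equations form a real linear system with
    only the zero solution.\<close>
  then have "t 1 = 0 \<and> t 2 = 0 \<and> t 3 = 0 \<and> t 4 = 0"
    by (auto simp: complex_eq_iff)
  then show "c = 0"
    by (simp add: vec_eq_iff forall_4 t_def)
qed

text \<open>If the combination vanishes on the interval, so do its derivatives at 0. Those of order
  0 to 3 are the entries of W(0) c, and W(0) is invertible.\<close>

lemma exp_comb_eq_0:
  assumes "l > 0" "\<alpha> > 0" and zero: "\<And>x. x \<in> {-l..l} \<Longrightarrow> exp_comb \<alpha> c x = 0"
  shows "c = 0"
proof -
  have z: "exp_comb \<alpha> 0 x = 0" for x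
    by (simp add: exp_comb_def)
  have "nderiv l n (exp_comb \<alpha> c) 0 = 0" for n
  proof -
    have "nderiv l n (exp_comb \<alpha> c) 0 = nderiv l n (exp_comb \<alpha> 0) 0"
      by (rule nderiv_cong) (use zero z assms in auto)
    then show ?thesis using assms by (simp add: nderiv_exp_comb zero_vec_def[symmetric] z)
  qed
  then have "W_mat \<alpha> 0 *v c = 0"
    using assms by (simp add: vec_eq_iff W_mat_mult nderiv_exp_comb)
  then show ?thesis
    using invertible_W_mat[OF assms(2), of 0] inj_matrix_vector_mult[of "W_mat \<alpha> 0"]
    by (metis injD matrix_vector_mult_0_right)
qed

lemma UNIV_8: "(UNIV :: 8 set) = {1, 2, 3, 4, 5, 6, 7, 8}"
proof -
  have "card {1, 2, 3, 4, 5, 6, 7, 8 :: 8} = CARD(8)" by simp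
  then show ?thesis by (metis card_eq_UNIV_imp_eq_UNIV finite)
qed

lemma sum_8: "sum f (UNIV :: 8 set) = f 1 + f 2 + f 3 + f 4 + f 5 + f 6 + f 7 + f 8"
  unfolding UNIV_8 by (simp add: ac_simps)

lemma minus_part_entries:
  "minus_part M $ i $ 1 = M $ i $ 1" "minus_part M $ i $ 2 = M $ i $ 2"
  "minus_part M $ i $ 3 = M $ i $ 3" "minus_part M $ i $ 4 = M $ i $ 4"
  by (simp_all only: minus_part_def vec_lambda_beta pos_4) simp_all

lemma plus_part_entries:
  "plus_part M $ i $ 1 = M $ i $ 5" "plus_part M $ i $ 2 = M $ i $ 6"
  "plus_part M $ i $ 3 = M $ i $ 7" "plus_part M $ i $ 4 = M $ i $ 8"
  by (simp_all only: plus_part_def vec_lambda_beta pos_4) simp_all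

lemma mult_vec_split:
  "M *v vector [a, b, c, d, e, f, g, h] =
     minus_part M *v vector [a, b, c, d] + plus_part M *v vector [e, f, g, h]"
  by (simp only: vec_eq_iff matrix_vector_mult_def sum_4 sum_8 minus_part_entries plus_part_entries
      vector_8 vector_4 add.assoc vec_lambda_beta vector_add_component simp_thms)

lemma mult_boundary_values_exp_comb:
  assumes l: "l > 0" and \<alpha>: "\<alpha> > 0"
  shows "M *v boundary_values l (exp_comb \<alpha> c) = tilde l \<alpha> M *v c"
proof -
  have W: "vector [nderiv l 0 (exp_comb \<alpha> c) x, nderiv l 1 (exp_comb \<alpha> c) x,
        nderiv l 2 (exp_comb \<alpha> c) x, nderiv l 3 (exp_comb \<alpha> c) x] = W_mat \<alpha> x *v c"
    if "x \<in> {-l..l}" for x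
    using l \<alpha> that by (simp add: vec_eq_iff forall_4 vector_4 W_mat_mult nderiv_exp_comb pos_4)
  show ?thesis
    using l W[of "-l"] W[of l] unfolding boundary_values_def mult_vec_split
    by (simp del: One_nat_def add: tilde_def tilde_minus_def tilde_plus_def matrix_vector_mult_add_rdistrib
        matrix_vector_mul_assoc)
qed

lemma well_posed_iff:
  assumes l: "l > 0" and \<alpha>: "\<alpha> > 0"
  shows "well_posed l \<alpha> M \<longleftrightarrow> invertible (tilde l \<alpha> M)"
proof
  assume wp: "well_posed l \<alpha> M"
  show "invertible (tilde l \<alpha> M)"
  proof (rule invertible_if_kernel_trivial)
    fix c assume "tilde l \<alpha> M *v c = 0"
    then have "\<forall>x\<in>{-l..l}. exp_comb \<alpha> c x = 0"
      using wp ode_solution_exp_comb[OF l \<alpha>] mult_boundary_values_exp_comb[OF l \<alpha>]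
      unfolding well_posed_def by metis
    then show "c = 0" using exp_comb_eq_0[OF l \<alpha>] by blast
  qed
next
  assume inv: "invertible (tilde l \<alpha> M)"
  show "well_posed l \<alpha> M"
    unfolding well_posed_def
  proof (intro allI impI)
    fix u assume u: "ode_solution l \<alpha> u \<and> M *v boundary_values l u = 0"
    then obtain c where c: "\<And>x. x \<in> {-l..l} \<Longrightarrow> u x = exp_comb \<alpha> c x"
      using ode_solution_is_exp_comb[OF l \<alpha>] by metis
    have nd: "nderiv l n u x = nderiv l n (exp_comb \<alpha> c) x" if "x \<in> {-l..l}" for n x
      by (rule nderiv_cong) (use c that in auto)
    have "boundary_values l u = boundary_values l (exp_comb \<alpha> c)"
      unfolding boundary_values_def using l by (simp add: nd)
    then have "tilde l \<alpha> M *v c = 0"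
      using u mult_boundary_values_exp_comb[OF l \<alpha>] by metis
    then have "c = 0"
      using inj_matrix_vector_mult[OF inv] by (metis injD matrix_vector_mult_0_right)
    then show "\<forall>x\<in>{-l..l}. u x = 0" using c by (simp add: exp_comb_def)
  qed
qed

subsection \<open>Conjugation symmetry and the matrix \<open>P\<close>\<close>

lemma matrix_inv_inverse:
  assumes "invertible A"
  shows "A ** matrix_inv A = mat 1" "matrix_inv A ** A = mat 1"
  using someI_ex[OF assms[unfolded invertible_def]] unfolding matrix_inv_def by blast+

lemma matrix_inv_cancel:
  assumes "invertible A"
  shows "X ** A ** matrix_inv A = X" "X ** matrix_inv A ** A = X"
  by (simp_all add: matrix_inv_inverse[OF assms] matrix_mul_assoc[symmetric])

lemma map_matrix_mult_cnj:
  "map_matrix cnj (A ** B) = map_matrix cnj A ** map_matrix cnj B"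
  by (simp add: vec_eq_iff matrix_matrix_mult_def)

lemma map_matrix_cnj_mat_1: "map_matrix cnj (mat 1) = mat 1"
  by (simp add: vec_eq_iff mat_def)

lemma matrix_diff_rdistrib: "(A - B) ** C = A ** C - B ** (C :: complex^'p^'n)" for A B :: "complex^'n^'m"
  by (simp add: vec_eq_iff matrix_matrix_mult_def left_diff_distrib sum_subtractf)

lemma R_mat_4: "(R_mat :: complex^4^4) = vector [vector [0,0,0,1], vector [0,0,1,0],
    vector [0,1,0,0], vector [1,0,0,0]]"
  by (simp add: vec_eq_iff forall_4 R_mat_def pos_4 vector_4)

lemma R_mat_sq: "R_mat ** R_mat = (mat 1 :: complex^4^4)"
  by (simp add: R_mat_4 vec_eq_iff forall_4 matrix_matrix_mult_def sum_4 vector_4 mat_def)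

lemma R_mat_cancel: "X ** R_mat ** R_mat = X" for X :: "complex^4^'n"
  by (simp add: R_mat_sq matrix_mul_assoc[symmetric])

lemma Omega_Lsq_invertible: "invertible (Omega ** Lsq)"
proof (rule invertible_mult)
  show "invertible Omega"
    by (rule invertible_if_kernel_trivial)
       (simp add: vec_eq_iff forall_4 matrix_vector_mult_def sum_4 Omega_def diag_mat_def vector_4
          omega_nonzero)
  show "invertible Lsq"
    by (rule invertible_if_kernel_trivial)
       (simp add: vec_eq_iff forall_4 matrix_vector_mult_def sum_4 Lsq_def vector_4)
qed

lemma E_mat_sq: "E_mat ** E_mat = mat 1"
  by (simp add: vec_eq_iff forall_4 matrix_matrix_mult_def sum_4 E_mat_def diag_mat_def vector_4 mat_def)

lemma E_mat_cancel: "X ** E_mat ** E_mat = X"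
  by (simp add: E_mat_sq matrix_mul_assoc[symmetric])

text \<open>Since R^2 = 1, the map A to R (cnj A) R is multiplicative, so its fixed points are
  closed under products.\<close>

lemma pi_bar_mult: "A \<in> pi_bar \<Longrightarrow> B \<in> pi_bar \<Longrightarrow> A ** B \<in> pi_bar" for A B :: "complex^4^4"
proof -
  assume "A \<in> pi_bar" "B \<in> pi_bar"
  then have "A ** B = (R_mat ** map_matrix cnj A ** R_mat) ** (R_mat ** map_matrix cnj B ** R_mat)"
    by (simp add: pi_bar_def)
  also have "\<dots> = R_mat ** map_matrix cnj (A ** B) ** R_mat"
    by (simp add: map_matrix_mult_cnj matrix_mul_assoc R_mat_cancel)
  finally show "A ** B \<in> pi_bar" by (simp add: pi_bar_def)
qed

lemma pi_bar_diff: "A \<in> pi_bar \<Longrightarrow> B \<in> pi_bar \<Longrightarrow> A - B \<in> pi_bar" for A B :: "complex^4^4"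
proof -
  have "map_matrix cnj (A - B) = map_matrix cnj A - map_matrix cnj B"
    by (simp add: vec_eq_iff)
  moreover have "R_mat ** (X - Y) = R_mat ** X - R_mat ** Y" for X Y :: "complex^4^4"
    by (simp add: vec_eq_iff matrix_matrix_mult_def right_diff_distrib sum_subtractf)
  ultimately show "A \<in> pi_bar \<Longrightarrow> B \<in> pi_bar \<Longrightarrow> A - B \<in> pi_bar"
    by (simp add: pi_bar_def matrix_diff_rdistrib)
qed

lemma mat_1_in_pi_bar: "mat 1 \<in> (pi_bar :: (complex^4^4) set)"
  by (simp add: pi_bar_def map_matrix_cnj_mat_1 R_mat_sq)

text \<open>Reduced to differences by A + B = A - (0 - B), with 0 written as 1 - 1.\<close>

lemma pi_bar_add: "A \<in> pi_bar \<Longrightarrow> B \<in> pi_bar \<Longrightarrow> A + B \<in> pi_bar" for A B :: "complex^4^4"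
  using pi_bar_diff[of A "mat 1 - mat 1 - B"] pi_bar_diff[of "mat 1 - mat 1" B]
    pi_bar_diff[OF mat_1_in_pi_bar mat_1_in_pi_bar] by simp

lemma E_mat_in_pi_bar: "E_mat \<in> pi_bar"
  by (simp add: pi_bar_def vec_eq_iff forall_4 matrix_matrix_mult_def sum_4 R_mat_4 E_mat_def
      diag_mat_def vector_4)

text \<open>Conjugation exchanges \<open>omega 1\<close> with \<open>omega 4\<close> and
  \<open>omega 2\<close> with \<open>omega 3\<close>, so it reverses the order of the
  columns.\<close>

lemma cnj_W_mat: "map_matrix cnj (W_mat \<alpha> x) = W_mat \<alpha> x ** R_mat"
  by (simp add: vec_eq_iff forall_4 matrix_matrix_mult_def sum_4 R_mat_4 vector_4 W_mat_def pos_4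
      exp_cnj cnj_omega)

text \<open>Inverting T R gives R T^-1, because R is its own inverse.\<close>

lemma cnj_matrix_inv:
  fixes T :: "complex^4^4"
  assumes T: "invertible T" and cnj: "map_matrix cnj T = T ** R_mat"
  shows "map_matrix cnj (matrix_inv T) = R_mat ** matrix_inv T"
proof -
  have "map_matrix cnj (matrix_inv T) ** T ** R_mat = map_matrix cnj (matrix_inv T ** T)"
    by (simp add: map_matrix_mult_cnj cnj matrix_mul_assoc)
  also have "\<dots> = mat 1"
    by (simp add: matrix_inv_inverse[OF T] map_matrix_cnj_mat_1)
  finally have "map_matrix cnj (matrix_inv T) ** T ** R_mat ** R_mat ** matrix_inv T = R_mat ** matrix_inv T"
    by simp
  then show ?thesis
    by (simp add: R_mat_cancel matrix_inv_cancel[OF T])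
qed

text \<open>For well-posed M this is unchanged when M is multiplied on the left by an invertible
  matrix: it forgets which equations express the boundary conditions.\<close>

definition P_mat :: "real \<Rightarrow> real \<Rightarrow> complex^8^4 \<Rightarrow> complex^4^4" where
  "P_mat l \<alpha> M = matrix_inv (tilde l \<alpha> M) ** tilde_plus l \<alpha> M"

lemma G_plus_eq: "G_plus l \<alpha> M = P_mat l \<alpha> M ** (Omega ** Lsq)"
  by (simp add: G_plus_def P_mat_def matrix_mul_assoc)

text \<open>The two normalised parts of \<open>tilde l \<alpha> M\<close> add up to the identity, so
  \<open>G_plus\<close> alone determines the Green's function.\<close>

lemma G_minus_eq:
  assumes "invertible (tilde l \<alpha> M)"
  shows "G_minus l \<alpha> M = Omega ** Lsq - G_plus l \<alpha> M"
proof -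
  have "matrix_inv (tilde l \<alpha> M) ** (tilde_minus l \<alpha> M + tilde_plus l \<alpha> M) = mat 1"
    using matrix_inv_inverse(2)[OF assms] by (simp add: tilde_def)
  then have "matrix_inv (tilde l \<alpha> M) ** tilde_minus l \<alpha> M = mat 1 - P_mat l \<alpha> M"
    by (simp add: P_mat_def matrix_add_ldistrib eq_diff_eq)
  then show ?thesis
    unfolding G_plus_eq by (simp add: G_minus_def matrix_diff_rdistrib matrix_mul_assoc)
qed

lemma G_plus_eq_iff: "G_plus l \<alpha> M = G_plus l \<alpha> N \<longleftrightarrow> P_mat l \<alpha> M = P_mat l \<alpha> N"
  unfolding G_plus_eq by (metis Omega_Lsq_invertible matrix_inv_cancel(1))

lemma G_mat_eq: "G_mat l \<alpha> M = (P_mat l \<alpha> M - P_mat l \<alpha> (Q_mat \<alpha>)) ** E_mat"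
  unfolding G_mat_def G_plus_eq
  by (simp only: matrix_diff_rdistrib matrix_inv_cancel[OF Omega_Lsq_invertible])

text \<open>As \<open>E_mat\<close> is its own inverse, P and \<open>G_mat\<close> are related by an
  invertible affine map; questions about \<open>G_mat\<close> thus become questions about P.\<close>

lemma G_mat_eq_iff_P_mat: "G_mat l \<alpha> M = A \<longleftrightarrow> P_mat l \<alpha> M = A ** E_mat + P_mat l \<alpha> (Q_mat \<alpha>)"
proof -
  have "G_mat l \<alpha> M = A \<longleftrightarrow> P_mat l \<alpha> M - P_mat l \<alpha> (Q_mat \<alpha>) = A ** E_mat"
    unfolding G_mat_eq by (metis E_mat_cancel)
  then show ?thesis by (simp add: diff_eq_eq)
qed

text \<open>For real M conjugation acts only through W: it puts an R to the right of
  \<open>tilde_plus\<close> and to the left of the inverse of \<open>tilde\<close>, so cnj P = R P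
  R.\<close>

lemma P_mat_in_pi_bar:
  assumes inv: "invertible (tilde l \<alpha> M)" and real: "\<And>i j. M $ i $ j \<in> \<real>"
  shows "P_mat l \<alpha> M \<in> pi_bar"
proof -
  have "map_matrix cnj (minus_part M) = minus_part M" "map_matrix cnj (plus_part M) = plus_part M"
    using real by (simp_all add: vec_eq_iff minus_part_def plus_part_def Reals_cnj_iff)
  then have *: "map_matrix cnj (tilde_minus l \<alpha> M) = tilde_minus l \<alpha> M ** R_mat"
    and p: "map_matrix cnj (tilde_plus l \<alpha> M) = tilde_plus l \<alpha> M ** R_mat"
    by (simp_all add: tilde_minus_def tilde_plus_def map_matrix_mult_cnj cnj_W_mat matrix_mul_assoc)
  have "map_matrix cnj (tilde l \<alpha> M) = map_matrix cnj (tilde_minus l \<alpha> M) + map_matrix cnj (tilde_plus l \<alpha> M)"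
    by (simp add: tilde_def vec_eq_iff)
  also have "\<dots> = tilde l \<alpha> M ** R_mat"
    unfolding * p tilde_def by (simp add: vec_eq_iff matrix_matrix_mult_def distrib_right sum.distrib)
  finally have "map_matrix cnj (tilde l \<alpha> M) = tilde l \<alpha> M ** R_mat" .
  from cnj_matrix_inv[OF inv this]
  show ?thesis
    by (simp add: pi_bar_def P_mat_def map_matrix_mult_cnj p matrix_mul_assoc R_mat_cancel R_mat_sq)
qed

section \<open>Well-posedness of Q\<close>

lemma sqrt2_alpha: "of_real (sqrt 2) * of_real \<alpha> = (1 - \<i>) * lam \<alpha> 1"
  by (simp add: lam_values(1) omega_one complex_eq_iff field_simps)

lemma alpha_sq: "of_real \<alpha> ^ 2 = - \<i> * lam \<alpha> 1 ^ 2"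
  using omega_one_sq by (simp add: lam_values(1) power2_eq_square mult_ac)
    (simp add: mult.assoc[symmetric])

text \<open>At -l the conditions admit only the exponentials q = 1, 4, which decay to the left; at l
  only q = 2, 3, which decay to the right. No nonzero combination satisfies both. In the computation
  every entry of Q is rewritten through \<mu> = \<open>lam \<alpha> 1\<close>.\<close>

lemma invertible_tilde_Q_mat:
  assumes \<alpha>: "\<alpha> > 0"
  shows "invertible (tilde l \<alpha> (Q_mat \<alpha>))"
proof (rule invertible_if_kernel_trivial)
  fix c assume "tilde l \<alpha> (Q_mat \<alpha>) *v c = 0"
  then have *: "minus_part (Q_mat \<alpha>) *v (W_mat \<alpha> (-l) *v c) + plus_part (Q_mat \<alpha>) *v (W_mat \<alpha> l *v c) = 0"
    by (simp add: tilde_def tilde_minus_def tilde_plus_def matrix_vector_mult_add_rdistrib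
        matrix_vector_mul_assoc)
  define a where "a = W_mat \<alpha> (-l) *v c"
  define b where "b = W_mat \<alpha> l *v c"
  define t where "t q = c $ q * exp (lam \<alpha> q * of_real (-l))" for q
  define s where "s q = c $ q * exp (lam \<alpha> q * of_real l)" for q
  define \<mu> where "\<mu> = lam \<alpha> 1"
  have \<mu>: "\<mu> \<noteq> 0" unfolding \<mu>_def using lam_nonzero[OF \<alpha>] .
  have cube: "of_real (sqrt 2) * of_real \<alpha> ^ 3 = ((- 1 - \<i>) * \<mu> ^ 3 :: complex)"
  proof -
    have "of_real (sqrt 2) * of_real \<alpha> ^ 3 = (of_real (sqrt 2) * of_real \<alpha>) * (of_real \<alpha> ^ 2 :: complex)"
      by (simp add: power3_eq_cube power2_eq_square)
    then show ?thesis unfolding sqrt2_alpha alpha_sq \<mu>_def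
      by (simp add: algebra_simps power3_eq_cube power2_eq_square)
  qed
  note W = W_mat_mult_components[of \<alpha> "-l" c, folded a_def t_def \<mu>_def]
    W_mat_mult_components[of \<alpha> l c, folded b_def s_def \<mu>_def]
  have rows: "of_real \<alpha> ^ 2 * a $ 2 - (of_real (sqrt 2) * of_real \<alpha>) * a $ 3 + a $ 4 = 0"
    "(of_real (sqrt 2) * of_real \<alpha> ^ 3) * a $ 1 - of_real \<alpha> ^ 2 * a $ 2 + a $ 4 = 0"
    "of_real \<alpha> ^ 2 * b $ 2 + (of_real (sqrt 2) * of_real \<alpha>) * b $ 3 + b $ 4 = 0"
    "- (of_real (sqrt 2) * of_real \<alpha> ^ 3) * b $ 1 - of_real \<alpha> ^ 2 * b $ 2 + b $ 4 = 0"
    using *[folded a_def b_def]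
    by (simp_all add: vec_eq_iff forall_4 matrix_vector_mult_def sum_4 minus_part_entries
        plus_part_entries Q_mat_def vector_4 vector_8)
  \<comment> \<open>In the rows for -l the terms with q = 1, 4 cancel; in the rows for l those with
    q = 2, 3 do. Each pair leaves a difference and a sum of the two remaining terms.\<close>
  have "\<mu> ^ 3 * ((2 - 2 * \<i>) * (t 2 - t 3)) = 0"
    using rows(1) unfolding sqrt2_alpha alpha_sq \<mu>_def[symmetric] W
    by (simp add: algebra_simps power3_eq_cube power2_eq_square)
  moreover have "\<mu> ^ 3 * ((- 2 - 2 * \<i>) * (t 2 + t 3)) = 0"
    using rows(2) unfolding cube alpha_sq \<mu>_def[symmetric] W
    by (simp add: algebra_simps power3_eq_cube power2_eq_square)
  moreover have "\<mu> ^ 3 * ((2 - 2 * \<i>) * (s 1 - s 4)) = 0"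
    using rows(3) unfolding sqrt2_alpha alpha_sq \<mu>_def[symmetric] W
    by (simp add: algebra_simps power3_eq_cube power2_eq_square)
  moreover have "\<mu> ^ 3 * ((2 + 2 * \<i>) * (s 1 + s 4)) = 0"
    using rows(4) unfolding cube alpha_sq \<mu>_def[symmetric] W
    by (simp add: algebra_simps power3_eq_cube power2_eq_square)
  moreover have "2 - 2 * \<i> \<noteq> 0" "- 2 - 2 * \<i> \<noteq> 0" "2 + 2 * \<i> \<noteq> 0"
    by (simp_all add: complex_eq_iff)
  ultimately have "t 2 - t 3 = 0" "t 2 + t 3 = 0" "s 1 - s 4 = 0" "s 1 + s 4 = 0"
    using \<mu> by (simp_all only: mult_eq_0_iff power_eq_0_iff simp_thms)
  then have "t 2 = 0 \<and> t 3 = 0 \<and> s 1 = 0 \<and> s 4 = 0"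
    by (auto simp: add_eq_0_iff complex_eq_iff)
  then show "c = 0"
    by (simp add: vec_eq_iff forall_4 t_def s_def)
qed

lemma P_mat_Q_mat_in_pi_bar:
  assumes "\<alpha> > 0"
  shows "P_mat l \<alpha> (Q_mat \<alpha>) \<in> pi_bar"
  using invertible_tilde_Q_mat[OF assms] by (rule P_mat_in_pi_bar) (simp add: Q_mat_def)

section \<open>A boundary matrix with prescribed P\<close>

definition join_blocks :: "complex^4^4 \<Rightarrow> complex^4^4 \<Rightarrow> complex^8^4" where
  "join_blocks A B = (\<chi> i. vector [A $ i $ 1, A $ i $ 2, A $ i $ 3, A $ i $ 4,
                              B $ i $ 1, B $ i $ 2, B $ i $ 3, B $ i $ 4])"

lemma minus_part_join_blocks: "minus_part (join_blocks A B) = A"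
  unfolding vec_eq_iff[of "minus_part (join_blocks A B)" A] vec_eq_iff[of "minus_part (join_blocks A B) $ _"]
    forall_4[of "\<lambda>j. minus_part (join_blocks A B) $ _ $ j = _ j"] minus_part_entries
  by (simp add: join_blocks_def vector_8)

lemma plus_part_join_blocks: "plus_part (join_blocks A B) = B"
  unfolding vec_eq_iff[of "plus_part (join_blocks A B)" B] vec_eq_iff[of "plus_part (join_blocks A B) $ _"]
    forall_4[of "\<lambda>j. plus_part (join_blocks A B) $ _ $ j = _ j"] plus_part_entries
  by (simp add: join_blocks_def vector_8)

lemma join_blocks_real:
  assumes "map_matrix cnj A = A" "map_matrix cnj B = B"
  shows "join_blocks A B $ i $ j \<in> \<real>"
proof -
  have "A $ i $ q \<in> \<real>" "B $ i $ q \<in> \<real>" for q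
    using assms by (simp_all add: Reals_cnj_iff vec_eq_iff)
  moreover have "j \<in> {1, 2, 3, 4, 5, 6, 7, 8}"
    unfolding UNIV_8[symmetric] by simp
  ultimately show ?thesis
    by (elim insertE emptyE) (simp_all only: join_blocks_def vec_lambda_beta vector_8)
qed

text \<open>The normalisation \<open>tilde = W(0)\<close> instead of the identity makes the constructed matrix real
  whenever \<open>P\<close> is symmetric.\<close>
lemma P_mat_surj:
  assumes \<alpha>: "\<alpha> > 0"
  obtains M where "invertible (tilde l \<alpha> M)" "P_mat l \<alpha> M = P"
    "P \<in> pi_bar \<Longrightarrow> \<forall>i j. M $ i $ j \<in> \<real>"
proof -
  define X where "X Z x = W_mat \<alpha> 0 ** Z ** matrix_inv (W_mat \<alpha> x)" for Z x
  define M where "M = join_blocks (X (mat 1 - P) (-l)) (X P l)"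
  have XW: "X Z x ** W_mat \<alpha> x = W_mat \<alpha> 0 ** Z" for Z x
    unfolding X_def by (rule matrix_inv_cancel(2)[OF invertible_W_mat[OF \<alpha>]])
  have p: "tilde_plus l \<alpha> M = W_mat \<alpha> 0 ** P"
    by (simp add: M_def tilde_plus_def plus_part_join_blocks XW)
  have "tilde_minus l \<alpha> M = W_mat \<alpha> 0 ** (mat 1 - P)"
    by (simp add: M_def tilde_minus_def minus_part_join_blocks XW)
  then have t: "tilde l \<alpha> M = W_mat \<alpha> 0"
    by (simp add: tilde_def p matrix_add_ldistrib[symmetric])
  have "invertible (tilde l \<alpha> M)"
    using t invertible_W_mat[OF \<alpha>] by simp
  moreover have "P_mat l \<alpha> M = P"
    unfolding P_mat_def t p
    by (simp add: matrix_mul_assoc matrix_inv_inverse[OF invertible_W_mat[OF \<alpha>]])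
  moreover have "\<forall>i j. M $ i $ j \<in> \<real>" if P: "P \<in> pi_bar"
  proof -
    have X: "map_matrix cnj (X Z x) = X Z x" if "Z \<in> pi_bar" for Z x
    proof -
      \<comment> \<open>The R from cnj W(0) and the R from the conjugated inverse enclose cnj Z, so
        the symmetry of Z restores X.\<close>
      have "map_matrix cnj (X Z x) = W_mat \<alpha> 0 ** (R_mat ** map_matrix cnj Z ** R_mat) ** matrix_inv (W_mat \<alpha> x)"
        unfolding X_def map_matrix_mult_cnj cnj_W_mat cnj_matrix_inv[OF invertible_W_mat[OF \<alpha>] cnj_W_mat]
        by (simp only: matrix_mul_assoc)
      then show ?thesis using that by (simp add: pi_bar_def X_def)
    qed
    show ?thesis
      unfolding M_def using P pi_bar_diff[OF mat_1_in_pi_bar P] by (auto intro!: join_blocks_real X)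
  qed
  ultimately show ?thesis by (rule that)
qed

subsection \<open>Equality of the integral operators\<close>

lemma bilin_y_vec_diff:
  "bilin (y_vec \<alpha> x) A (y_vec \<alpha> \<xi>) - bilin (y_vec \<alpha> x) B (y_vec \<alpha> \<xi>) = bilin (y_vec \<alpha> x) (A - B) (y_vec \<alpha> \<xi>)"
  by (simp add: bilin_def matrix_vector_mult_diff_rdistrib right_diff_distrib sum_subtractf)

lemma bilin_y_vec:
  "bilin (y_vec \<alpha> x) A (y_vec \<alpha> \<xi>) = (\<Sum>p\<in>UNIV. exp (lam \<alpha> p * of_real x) * exp_comb \<alpha> (A $ p) \<xi>)"
  by (simp add: bilin_def y_vec_def exp_comb_def matrix_vector_mult_def lam_def)

text \<open>For \<xi> < x the minus sign of the Green's function meets the minus sign of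
  \<open>G_plus\<close> in \<open>G_minus_eq\<close>, so one formula serves both sides of the
  diagonal.\<close>

lemma green_diff:
  assumes M: "invertible (tilde l \<alpha> M)" and N: "invertible (tilde l \<alpha> N)"
  shows "green l \<alpha> k M x \<xi> - green l \<alpha> k N x \<xi> =
    of_real (\<alpha> / (4 * k)) * bilin (y_vec \<alpha> x) (G_plus l \<alpha> M - G_plus l \<alpha> N) (y_vec \<alpha> \<xi>)"
proof (cases "x \<le> \<xi>")
  case True
  then show ?thesis
    by (simp add: green_def bilin_y_vec_diff[symmetric] right_diff_distrib)
next
  case False
  have "G_minus l \<alpha> N - G_minus l \<alpha> M = G_plus l \<alpha> M - G_plus l \<alpha> N"
    by (simp add: G_minus_eq[OF M] G_minus_eq[OF N])
  then have "bilin (y_vec \<alpha> x) (G_plus l \<alpha> M - G_plus l \<alpha> N) (y_vec \<alpha> \<xi>) =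
    bilin (y_vec \<alpha> x) (G_minus l \<alpha> N) (y_vec \<alpha> \<xi>) - bilin (y_vec \<alpha> x) (G_minus l \<alpha> M) (y_vec \<alpha> \<xi>)"
    by (simp add: bilin_y_vec_diff)
  then show ?thesis
    using False by (simp add: green_def right_diff_distrib)
qed

lemma continuous_imp_L2_fun:
  assumes "continuous_on {-l..l} w"
  shows "w \<in> L2_fun l"
proof -
  have "w \<in> borel_measurable (lebesgue_on {-l..l})"
    using assms by (rule continuous_imp_measurable_on_sets_lebesgue) simp
  moreover have "integrable (lebesgue_on {-l..l}) (\<lambda>x. (norm (w x))\<^sup>2)"
    by (intro continuous_imp_integrable_real continuous_intros assms)
  ultimately show ?thesis by (simp add: L2_fun_def)
qed

lemma integrable_if:
  fixes f g :: "'a \<Rightarrow> 'b::{banach, second_countable_topology}"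
  assumes P: "{x \<in> space M. P x} \<in> sets M" and f: "integrable M f" and g: "integrable M g"
  shows "integrable M (\<lambda>x. if P x then f x else g x)"
proof -
  let ?A = "{x \<in> space M. P x}"
  have "integrable M (\<lambda>x. indicator ?A x *\<^sub>R f x + indicator (space M - ?A) x *\<^sub>R g x)"
    by (intro Bochner_Integration.integrable_add integrable_mult_indicator f g P sets.compl_sets)
  then show ?thesis
    by (rule Bochner_Integration.integrable_cong[THEN iffD1, OF refl, rotated])
       (auto simp: indicator_def)
qed

lemma integrable_green_mult:
  assumes w: "continuous_on {-l..l} w"
  shows "integrable (lebesgue_on {-l..l}) (\<lambda>\<xi>. green l \<alpha> k M x \<xi> * w \<xi>)"
proof -
  have c: "integrable (lebesgue_on {-l..l}) (\<lambda>\<xi>. a * bilin (y_vec \<alpha> x) A (y_vec \<alpha> \<xi>) * w \<xi>)" for a A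
    unfolding bilin_y_vec
    by (intro continuous_imp_integrable_real continuous_intros continuous_on_exp_comb w)
  have "(\<lambda>\<xi>. \<xi>) \<in> borel_measurable (lebesgue_on {-l..l})"
    by (rule continuous_imp_measurable_on_sets_lebesgue) simp_all
  then have "{\<xi> \<in> space (lebesgue_on {-l..l}). x \<le> \<xi>} \<in> sets (lebesgue_on {-l..l})"
    by measurable
  from integrable_if[OF this c[of "of_real (\<alpha> / (4 * k))" "G_plus l \<alpha> M"]
      c[of "- of_real (\<alpha> / (4 * k))" "G_minus l \<alpha> M"]]
  show ?thesis by (simp only: green_def if_distrib[of "\<lambda>z. z * _"])
qed

text \<open>The integral of the continuous nonnegative function |f| is zero. This passes from
  equality in L^2 to equality at every point.\<close>

lemma continuous_AE_eq_0:
  fixes f :: "real \<Rightarrow> complex"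
  assumes "a < b" and f: "continuous_on {a..b} f" and ae: "AE x in lebesgue_on {a..b}. f x = 0"
    and x: "x \<in> {a..b}"
  shows "f x = 0"
proof -
  have "(LINT x|lebesgue_on {a..b}. norm (f x)) = 0"
    using ae by (intro integral_eq_zero_AE) auto
  moreover have "continuous_on {a..b} (\<lambda>x. norm (f x))"
    using f by (rule continuous_on_norm)
  ultimately show ?thesis
    using integralL_eq_0_iff[of a b "\<lambda>x. norm (f x)"] \<open>a < b\<close> x by simp
qed

text \<open>Independence of the exponentials is used twice: in x, to extract the single coefficient
  belonging to row p, and in \<xi>, to conclude that row p of the difference is zero.\<close>

lemma K_op_eq_imp_G_plus_eq:
  assumes l: "l > 0" and \<alpha>: "\<alpha> > 0" and k: "k > 0"
    and M: "invertible (tilde l \<alpha> M)" and N: "invertible (tilde l \<alpha> N)"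
    and K: "\<And>w. w \<in> L2_fun l \<Longrightarrow> L2_eq l (K_op l \<alpha> k M w) (K_op l \<alpha> k N w)"
  shows "G_plus l \<alpha> M = G_plus l \<alpha> N"
proof -
  define D where "D = G_plus l \<alpha> M - G_plus l \<alpha> N"
  define \<kappa> :: complex where "\<kappa> = of_real (\<alpha> / (4 * k))"
  have \<kappa>: "\<kappa> \<noteq> 0" using \<alpha> k by (simp add: \<kappa>_def)
  let ?L = "lebesgue_on {-l..l}"
  have "D $ p = 0" for p
  proof -
    \<comment> \<open>With this test function the p-th coefficient of the image under the difference
      is \<kappa> times the squared L^2 norm of the combination with coefficients
      \<open>D $ p\<close>.\<close>
    define w where "w \<xi> = cnj (exp_comb \<alpha> (D $ p) \<xi>)" for \<xi>
    have w: "continuous_on {-l..l} w"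
      unfolding w_def by (intro continuous_intros continuous_on_exp_comb)
    have int: "integrable ?L (\<lambda>\<xi>. \<kappa> * exp_comb \<alpha> (D $ q) \<xi> * w \<xi>)" for q
      by (intro continuous_imp_integrable_real continuous_intros continuous_on_exp_comb w)
    define c :: "complex^4" where "c = (\<chi> q. LINT \<xi>|?L. \<kappa> * exp_comb \<alpha> (D $ q) \<xi> * w \<xi>)"
    have diff: "K_op l \<alpha> k M w x - K_op l \<alpha> k N w x = exp_comb \<alpha> c x" for x
    proof -
      have "K_op l \<alpha> k M w x - K_op l \<alpha> k N w x =
          (LINT \<xi>|?L. green l \<alpha> k M x \<xi> * w \<xi> - green l \<alpha> k N x \<xi> * w \<xi>)"
        unfolding K_op_def
        by (rule Bochner_Integration.integral_diff[symmetric]) (rule integrable_green_mult[OF w])+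
      also have "\<dots> = (LINT \<xi>|?L. (\<Sum>q\<in>UNIV. exp (lam \<alpha> q * of_real x) * (\<kappa> * exp_comb \<alpha> (D $ q) \<xi> * w \<xi>)))"
        unfolding left_diff_distrib[symmetric] green_diff[OF M N] D_def[symmetric] \<kappa>_def[symmetric]
          bilin_y_vec
        by (simp only: sum_distrib_left sum_distrib_right mult_ac)
      also have "\<dots> = exp_comb \<alpha> c x"
        using int by (simp add: exp_comb_def c_def mult.commute)
      finally show ?thesis .
    qed
    have "AE x in ?L. exp_comb \<alpha> c x = 0"
      using K[OF continuous_imp_L2_fun[OF w]] unfolding L2_eq_def diff[symmetric] by simp
    then have "exp_comb \<alpha> c x = 0" if "x \<in> {-l..l}" for x
      using continuous_AE_eq_0[OF _ continuous_on_exp_comb _ that] l by auto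
    then have "c = 0" by (rule exp_comb_eq_0[OF l \<alpha>])
    then have "c $ p = 0" by simp
    then have "(LINT \<xi>|?L. exp_comb \<alpha> (D $ p) \<xi> * w \<xi>) = 0"
      using \<kappa> by (simp add: c_def mult.assoc)
    moreover have "exp_comb \<alpha> (D $ p) \<xi> * w \<xi> = of_real ((norm (exp_comb \<alpha> (D $ p) \<xi>))\<^sup>2)" for \<xi>
      unfolding w_def by (simp only: complex_norm_square)
    ultimately have "(LINT \<xi>|?L. (norm (exp_comb \<alpha> (D $ p) \<xi>))\<^sup>2) = 0"
      by (simp only: integral_complex_of_real of_real_eq_0_iff)
    moreover have "continuous_on {-l..l} (\<lambda>\<xi>. (norm (exp_comb \<alpha> (D $ p) \<xi>))\<^sup>2)"
      by (intro continuous_intros continuous_on_exp_comb)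
    ultimately have "\<forall>x\<in>{-l..l}. (norm (exp_comb \<alpha> (D $ p) x))\<^sup>2 = 0"
      using l by (subst (asm) integralL_eq_0_iff) auto
    then have "exp_comb \<alpha> (D $ p) x = 0" if "x \<in> {-l..l}" for x
      using that by simp
    then show "D $ p = 0" by (rule exp_comb_eq_0[OF l \<alpha>])
  qed
  then have "D = 0" by (simp add: vec_eq_iff)
  then show ?thesis by (simp add: D_def)
qed

section \<open>Equivalence classes and the bijection\<close>

lemma wp_equiv_iff:
  assumes l: "l > 0" and \<alpha>: "\<alpha> > 0" and k: "k > 0"
  shows "(M, N) \<in> wp_equiv l \<alpha> k \<longleftrightarrow>
    M \<in> wp_mat l \<alpha> \<and> N \<in> wp_mat l \<alpha> \<and> P_mat l \<alpha> M = P_mat l \<alpha> N"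
proof
  assume "(M, N) \<in> wp_equiv l \<alpha> k"
  then show "M \<in> wp_mat l \<alpha> \<and> N \<in> wp_mat l \<alpha> \<and> P_mat l \<alpha> M = P_mat l \<alpha> N"
    using K_op_eq_imp_G_plus_eq[OF l \<alpha> k, of M N]
    by (auto simp: wp_equiv_def wp_mat_def well_posed_iff[OF l \<alpha>] G_plus_eq_iff)
next
  assume *: "M \<in> wp_mat l \<alpha> \<and> N \<in> wp_mat l \<alpha> \<and> P_mat l \<alpha> M = P_mat l \<alpha> N"
  then have "G_plus l \<alpha> M = G_plus l \<alpha> N" by (simp add: G_plus_eq_iff)
  moreover have "invertible (tilde l \<alpha> M)" "invertible (tilde l \<alpha> N)"
    using * by (simp_all add: wp_mat_def well_posed_iff[OF l \<alpha>])
  ultimately have "green l \<alpha> k M = green l \<alpha> k N"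
    by (simp add: green_def G_minus_eq fun_eq_iff)
  then have "K_op l \<alpha> k M = K_op l \<alpha> k N"
    by (simp add: K_op_def fun_eq_iff)
  then show "(M, N) \<in> wp_equiv l \<alpha> k"
    using * by (simp add: wp_equiv_def L2_eq_def)
qed

theorem lemma6p1:
  fixes l \<alpha> k :: real
  assumes "l > 0" and "\<alpha> > 0" and "k > 0"
  shows "(\<forall>M\<in>wp_mat l \<alpha>. Gamma_map l \<alpha> k (wp_class l \<alpha> k M) = G_mat l \<alpha> M) \<and>
         bij_betw (Gamma_map l \<alpha> k) (wp_C l \<alpha> k) UNIV \<and>
         Gamma_map l \<alpha> k ` wp_R l \<alpha> k = pi_bar"
proof -
  have wp: "M \<in> wp_mat l \<alpha> \<longleftrightarrow> invertible (tilde l \<alpha> M)" for M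
    using assms by (simp add: wp_mat_def well_posed_iff)
  have G: "G_mat l \<alpha> M = G_mat l \<alpha> N \<longleftrightarrow> P_mat l \<alpha> M = P_mat l \<alpha> N" for M N
    unfolding G_mat_eq_iff_P_mat[of l \<alpha> M] unfolding G_mat_eq E_mat_cancel by simp
  \<comment> \<open>The classes are the fibres of \<open>G_mat\<close>; hence
    \<open>the_elem\<close> in \<open>Gamma_map\<close> is applied to a singleton, and
    \<open>Gamma_map\<close> is injective.\<close>
  have cls: "wp_class l \<alpha> k M = {N \<in> wp_mat l \<alpha>. G_mat l \<alpha> N = G_mat l \<alpha> M}"
    if "M \<in> wp_mat l \<alpha>" for M
    unfolding wp_class_def using that G by (auto simp: wp_equiv_iff[OF assms])
  have Gamma: "Gamma_map l \<alpha> k (wp_class l \<alpha> k M) = G_mat l \<alpha> M" if M: "M \<in> wp_mat l \<alpha>" for M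
  proof -
    have "G_mat l \<alpha> ` wp_class l \<alpha> k M = {G_mat l \<alpha> M}"
      using M unfolding cls[OF M] by auto
    then show ?thesis by (simp add: Gamma_map_def)
  qed
  have wp_C: "wp_C l \<alpha> k = wp_class l \<alpha> k ` wp_mat l \<alpha>"
    by (auto simp: wp_C_def quotient_def wp_class_def)
  \<comment> \<open>One witness serves both claims: it gives surjectivity, and it is real when A
    lies in \<open>pi_bar\<close>, which gives the inclusion of \<open>pi_bar\<close> in the image
    of \<open>wp_R\<close>.\<close>
  have surj: "\<exists>M. M \<in> wp_mat l \<alpha> \<and> G_mat l \<alpha> M = A \<and> (A \<in> pi_bar \<longrightarrow> M \<in> wp_mat_real l \<alpha>)" for A
  proof -
    obtain M where M: "invertible (tilde l \<alpha> M)"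
      and P: "P_mat l \<alpha> M = A ** E_mat + P_mat l \<alpha> (Q_mat \<alpha>)"
      and real: "A ** E_mat + P_mat l \<alpha> (Q_mat \<alpha>) \<in> pi_bar \<Longrightarrow> \<forall>i j. M $ i $ j \<in> \<real>"
      using P_mat_surj[OF assms(2)] by metis
    have "A ** E_mat + P_mat l \<alpha> (Q_mat \<alpha>) \<in> pi_bar" if "A \<in> pi_bar"
      by (intro pi_bar_add pi_bar_mult that E_mat_in_pi_bar P_mat_Q_mat_in_pi_bar assms)
    then show ?thesis
      using M P real by (auto simp: wp wp_mat_real_def G_mat_eq_iff_P_mat)
  qed
  have "bij_betw (Gamma_map l \<alpha> k) (wp_C l \<alpha> k) UNIV"
  proof (rule bij_betwI')
    fix c d assume "c \<in> wp_C l \<alpha> k" "d \<in> wp_C l \<alpha> k"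
    then show "Gamma_map l \<alpha> k c = Gamma_map l \<alpha> k d \<longleftrightarrow> c = d"
      unfolding wp_C using Gamma cls by auto
  next
    fix A show "\<exists>c\<in>wp_C l \<alpha> k. A = Gamma_map l \<alpha> k c"
      using surj[of A] Gamma unfolding wp_C by auto
  qed simp
  moreover have "Gamma_map l \<alpha> k ` wp_R l \<alpha> k = pi_bar"
  proof -
    have "wp_R l \<alpha> k = wp_class l \<alpha> k ` wp_mat_real l \<alpha>"
      by (auto simp: wp_R_def)
    then have "Gamma_map l \<alpha> k ` wp_R l \<alpha> k = G_mat l \<alpha> ` wp_mat_real l \<alpha>"
      using Gamma by (simp add: image_image wp_mat_real_def)
    moreover have "G_mat l \<alpha> M \<in> pi_bar" if "M \<in> wp_mat_real l \<alpha>" for M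
      unfolding G_mat_eq using that
      by (intro pi_bar_mult pi_bar_diff E_mat_in_pi_bar P_mat_Q_mat_in_pi_bar assms P_mat_in_pi_bar)
         (auto simp: wp_mat_real_def wp)
    moreover have "A \<in> G_mat l \<alpha> ` wp_mat_real l \<alpha>" if "A \<in> pi_bar" for A
      using surj[of A] that by (metis image_eqI)
    ultimately show ?thesis by auto
  qed
  ultimately show ?thesis using Gamma by simp
qed

end
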